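(* Let $\boldsymbol{\Sigma}$ be symmetric positive definite on $\mathbb{R}^d$, $f(\mathbf{x})=\mathrm{pos}(\mathbf{r}_*^{\mathsf T}\mathbf{x})$ with $\mathbf{r}_*\neq\mathbf{0}$, $q\ge2$, $1\le k\le q-1$, and let $\boldsymbol{\Sigma}_B,\boldsymbol{\Sigma}_D$ be the bag and pair covariance matrices of the oracle $\mathrm{Ex}(f,N(\mathbf{0},\boldsymbol{\Sigma}),q,k)$. Set $\kappa_1:=(2k/q-1)^2\frac2\pi$ and $\kappa_2:=\frac1{q-1}\frac kq(1-\frac kq)\frac{16}\pi$. For nonzero $\mathbf{r}$, let $\rho(\mathbf{r}):=\mathbf{r}^{\mathsf T}\boldsymbol{\Sigma}_D\mathbf{r}/\mathbf{r}^{\mathsf T}\boldsymbol{\Sigma}_B\mathbf{r}$ and $\gamma(\mathbf{r}):=\frac{\mathbf{r}^{\mathsf T}\boldsymbol{\Sigma}\mathbf{r}_*}{\sqrt{\mathbf{r}^{\mathsf T}\boldsymbol{\Sigma}\mathbf{r}}\sqrt{\mathbf{r}_*^{\mathsf T}\boldsymbol{\Sigma}\mathbf{r}_*}}$. Then $\mathbf{r}^{\mathsf T}\boldsymbol{\Sigma}_B\mathbf{r}=\mathbf{r}^{\mathsf T}\boldsymbol{\Sigma}\mathbf{r}(1-\gamma(\mathbf{r})^2\kappa_1)$, $\mathbf{r}^{\mathsf T}\boldsymbol{\Sigma}_D\mathbf{r}=\mathbf{r}^{\mathsf T}\boldsymbol{\Sigma}\mathbf{r}(2-\gamma(\mathbf{r})^2(2\kappa_1-\kappa_2))$,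 $\rho(\mathbf{r})=2+\frac{\gamma(\mathbf{r})^2\kappa_2}{1-\gamma(\mathbf{r})^2\kappa_1}$, and $\rho$ is maximized at $\mathbf{r}=\pm\mathbf{r}_*$.
   Context: $\mathrm{pos}(a)=1$ if $a>0$, else $0$. The bag oracle $\mathrm{Ex}(f,\mathcal{D},q,k)$ returns a bag of $q$ independent points, $k$ drawn from $\mathcal{D}$ conditioned on $f=1$ and $q-k$ from $\mathcal{D}$ conditioned on $f=0$. $\boldsymbol{\Sigma}_B:=\mathrm{Var}[\mathbf{X}]$ where $\mathbf{X}$ is a uniformly random point of a random bag; $\boldsymbol{\Sigma}_D:=\mathbb{E}[\mathbf{Z}\mathbf{Z}^{\mathsf T}]$ where $\mathbf{Z}=\mathbf{X}_1-\mathbf{X}_2$ for a uniformly random pair $(\mathbf{X}_1,\mathbf{X}_2)$ drawn without replacement from a random bag. *)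

theory Defs
  imports "HOL-Analysis.Analysis"
begin

definition pos :: "real \<Rightarrow> real" where
  "pos a = (if a > 0 then 1 else 0)"

text \<open>Density of the multivariate normal N(0,S) on real^'d (w.r.t. Lebesgue measure).\<close>
definition gauss_pdf :: "real^'d^'d \<Rightarrow> real^'d \<Rightarrow> real" where
  "gauss_pdf S x = exp (- (x \<bullet> (matrix_inv S *v x)) / 2) / sqrt ((2 * pi) ^ CARD('d) * det S)"

definition gauss :: "real^'d^'d \<Rightarrow> (real^'d) measure" where
  "gauss S = density lborel (\<lambda>x. ennreal (gauss_pdf S x))"

text \<open>Distribution of a bag from Ex(f,D,q,k): q independent points, the first k drawn from
  D conditioned on f = 1, the remaining q-k drawn from D conditioned on f = 0.\<close>
definition bag_measure :: "(real^'d) measure \<Rightarrow> (real^'d \<Rightarrow> real) \<Rightarrow> nat \<Rightarrow> nat \<Rightarrow> (nat \<Rightarrow> real^'d) measure" where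
  "bag_measure D f q k = PiM {..<q} (\<lambda>i. if i < k then uniform_measure D {x. f x = 1}
                                        else uniform_measure D {x. f x = 0})"

text \<open>A random bag together with a uniformly random index into it.\<close>
definition point_measure' :: "(real^'d) measure \<Rightarrow> (real^'d \<Rightarrow> real) \<Rightarrow> nat \<Rightarrow> nat \<Rightarrow> (nat \<times> (nat \<Rightarrow> real^'d)) measure" where
  "point_measure' D f q k = uniform_count_measure {..<q} \<Otimes>\<^sub>M bag_measure D f q k"

text \<open>A random bag together with a uniformly random ordered pair of distinct indices.\<close>
definition pair_point_measure :: "(real^'d) measure \<Rightarrow> (real^'d \<Rightarrow> real) \<Rightarrow> nat \<Rightarrow> nat \<Rightarrow> ((nat \<times> nat) \<times> (nat \<Rightarrow> real^'d)) measure" where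
  "pair_point_measure D f q k =
     uniform_count_measure {(i, j). i < q \<and> j < q \<and> i \<noteq> j} \<Otimes>\<^sub>M bag_measure D f q k"

text \<open>Sigma_B = Var[X], X a uniformly random point of a random bag.\<close>
definition Sigma_B :: "(real^'d) measure \<Rightarrow> (real^'d \<Rightarrow> real) \<Rightarrow> nat \<Rightarrow> nat \<Rightarrow> real^'d^'d" where
  "Sigma_B D f q k =
    (let M = point_measure' D f q k;
         X = (\<lambda>(i, b). b i);
         mu = (\<lambda>a. \<integral>\<omega>. (X \<omega>) $ a \<partial>M)
     in \<chi> a c. \<integral>\<omega>. ((X \<omega>) $ a - mu a) * ((X \<omega>) $ c - mu c) \<partial>M)"

text \<open>Sigma_D = E[Z Z^T], Z = X1 - X2 for a uniformly random pair drawn without replacement.\<close>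
definition Sigma_D :: "(real^'d) measure \<Rightarrow> (real^'d \<Rightarrow> real) \<Rightarrow> nat \<Rightarrow> nat \<Rightarrow> real^'d^'d" where
  "Sigma_D D f q k =
    (let M = pair_point_measure D f q k;
         Z = (\<lambda>((i, j), b). b i - b j)
     in \<chi> a c. \<integral>\<omega>. (Z \<omega>) $ a * (Z \<omega>) $ c \<partial>M)"

definition quad :: "real^'d^'d \<Rightarrow> real^'d \<Rightarrow> real" where
  "quad A r = r \<bullet> (A *v r)"

end

(* Both covariance forms only involve the first two moments of the two class-conditional
   distributions, i.e. of N(0,S) restricted to the half-spaces rstar.x > 0 and rstar.x <= 0.
   Factor S = A A^T with A^T rstar a positive multiple of a coordinate vector e_j; under x = A y
   the half-spaces become {y_j > 0} and {y_j <= 0} for a standard Gaussian y, whose coordinates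
   are independent.  Hence both classes have second moment S, and their means are +m and -m
   with m = sqrt(2/pi) S rstar / sqrt(rstar^T S rstar).  For a bag of k points from one class
   and q - k from the other this gives Sigma_B = S - ((2k-q)/q)^2 m m^T and
   Sigma_D = 2 S - 2((2k-q)^2 - q)/(q(q-1)) m m^T, while (r^T m)^2 = gamma(r)^2 (2/pi) r^T S r.
   Finally rho = 2 + g kappa2 / (1 - g kappa1) is increasing in g = gamma(r)^2, which is at
   most 1 by Cauchy-Schwarz, with equality at r = +-rstar. *)

theory Submission
  imports Defs "HOL-Probability.Probability"
begin

section \<open>Lebesgue measure under linear maps\<close>

lemma det_matrix_shear:
  fixes m n :: "'n::finite"
  assumes "m \<noteq> n"
  shows "det (matrix (\<lambda>v::real^'n. \<chi> i. if i = m then v $ m + v $ n else v $ i)) = 1"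
proof -
  have "matrix (\<lambda>v::real^'n. \<chi> i. if i = m then v $ m + v $ n else v $ i)
      = (\<chi> k. if k = m then row m (mat 1) + 1 *s row n (mat 1) else row k (mat 1))"
    by (auto simp: matrix_def vec_eq_iff row_def mat_def axis_def)
  then show ?thesis
    using det_row_operation[OF assms, of "mat 1 :: real^'n^'n" 1] by simp
qed

lemma det_matrix_swap_coordinates:
  "\<bar>det (matrix (\<lambda>v::real^'n::finite. \<chi> i. v $ Transposition.transpose m n i))\<bar> = 1"
proof -
  have "matrix (\<lambda>v::real^'n. \<chi> i. v $ Transposition.transpose m n i)
      = (\<chi> i j. mat 1 $ i $ Transposition.transpose m n j)"
    by (auto simp: matrix_def vec_eq_iff mat_def axis_def Transposition.transpose_def)
  then show ?thesis
    by (simp add: det_permute_columns permutes_swap_id sign_swap_id)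
qed

lemma measure_swap_coordinates_image:
  fixes S :: "(real^'n::finite) set"
  assumes "S \<in> lmeasurable"
  shows "(\<lambda>v. \<chi> i. v $ Transposition.transpose m n i) ` S \<in> lmeasurable \<and>
         measure lebesgue ((\<lambda>v. \<chi> i. v $ Transposition.transpose m n i) ` S) = measure lebesgue S"
proof -
  let ?h = "\<lambda>v::real^'n. \<chi> i. v $ Transposition.transpose m n i"
  have lin: "linear ?h"
    by (rule linearI) (simp_all add: plus_vec_def scaleR_vec_def)
  have box: "?h ` cbox a b = cbox (?h a) (?h b)" for a b
  proof -
    have inv: "?h (?h x) = x" for x by (simp add: vec_eq_iff)
    have "x \<in> ?h ` cbox a b" if x: "x \<in> cbox (?h a) (?h b)" for x
    proof (rule image_eqI)
      show "x = ?h (?h x)" by (simp add: inv)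
      have "a $ i \<le> ?h x $ i \<and> ?h x $ i \<le> b $ i" for i
        using x[unfolded mem_box_cart, rule_format, of "Transposition.transpose m n i"] by simp
      then show "?h x \<in> cbox a b" by (simp add: mem_box_cart)
    qed
    then show ?thesis by (auto simp: mem_box_cart)
  qed
  have "measure lebesgue (?h ` cbox a b) = measure lebesgue (cbox a b)" for a b
  proof (cases "cbox a b = {}")
    case False
    then have "cbox (?h a) (?h b) \<noteq> {}" using box by auto
    then show ?thesis
      using False prod.permute[OF permutes_swap_id, where S=UNIV and g="\<lambda>i. (b - a) $ i"]
      by (simp add: box content_cbox_cart comp_def)
  qed simp
  then show ?thesis
    using measure_linear_sufficient[OF lin assms, of 1] by (simp add: eq_commute)
qed

lemma measure_shear_image:
  fixes S :: "(real^'n::finite) set"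
  assumes "m \<noteq> n" and "S \<in> lmeasurable"
  shows "(\<lambda>v. \<chi> i. if i = m then v $ m + v $ n else v $ i) ` S \<in> lmeasurable \<and>
         measure lebesgue ((\<lambda>v. \<chi> i. if i = m then v $ m + v $ n else v $ i) ` S) = measure lebesgue S"
proof -
  let ?h = "\<lambda>v::real^'n. \<chi> i. if i = m then v $ m + v $ n else v $ i"
  have lin: "linear ?h"
    by (rule linearI) (auto simp: algebra_simps vec_eq_iff)
  have "measure lebesgue (?h ` cbox a b) = measure lebesgue (cbox a b)" for a b
  proof (cases "cbox a b = {}")
    case False
    \<comment> \<open>\<open>measure_shear_interval\<close> needs \<open>0 \<le> a $ n\<close>, so translate the box first.\<close>
    define t :: "real^'n" where "t = (\<chi> i. if i = n then - a $ n else 0)"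
    have "?h ` cbox a b = (+) (- ?h t) ` ?h ` (+) t ` cbox a b"
      using \<open>m \<noteq> n\<close> unfolding image_comp o_def by (force simp: vec_eq_iff t_def)
    also have "\<dots> = (+) (- ?h t) ` ?h ` cbox (t + a) (t + b)"
      by (simp add: cbox_translation)
    finally have "measure lebesgue (?h ` cbox a b) = measure lebesgue (?h ` cbox (t + a) (t + b))"
      by (simp only: measure_translation)
    also have "\<dots> = measure lebesgue (cbox (t + a) (t + b))"
    proof (rule measure_shear_interval[OF \<open>m \<noteq> n\<close>])
      show "cbox (t + a) (t + b) \<noteq> {}"
        using False by (metis cbox_translation image_is_empty)
      then show "0 \<le> (t + a) $ n"
        by (simp add: t_def)
    qed
    also have "\<dots> = measure lebesgue (cbox a b)"
      by (simp only: cbox_translation measure_translation)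
    finally show ?thesis .
  qed simp
  then show ?thesis
    using measure_linear_sufficient[OF lin \<open>S \<in> lmeasurable\<close>, of 1] by (simp add: eq_commute)
qed

text \<open>\<open>Change_Of_Vars\<close> proves the following only for index types of class \<open>wellorder\<close>, which it
  needs solely for the determinant of a shear; \<open>det_matrix_shear\<close> removes that restriction.\<close>

proposition
  fixes f :: "real^'n::finite \<Rightarrow> real^'n"
  assumes "linear f" and "S \<in> lmeasurable"
  shows lmeasurable_linear_image_gen: "f ` S \<in> lmeasurable"
    and measure_linear_image_gen: "measure lebesgue (f ` S) = \<bar>det (matrix f)\<bar> * measure lebesgue S"
proof -
  define P where "P f \<longleftrightarrow> (\<forall>S \<in> lmeasurable. f ` S \<in> lmeasurable \<and>
    measure lebesgue (f ` S) = \<bar>det (matrix f)\<bar> * measure lebesgue S)" for f :: "real^'n \<Rightarrow> real^'n"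
  have "P f"
  proof (rule induct_linear_elementary[OF \<open>linear f\<close>])
    show "P (f \<circ> g)" if "linear f" "linear g" "P f" "P g" for f g
      using that matrix_compose[OF \<open>linear g\<close> \<open>linear f\<close>]
      unfolding P_def image_comp[symmetric] by (simp add: det_mul abs_mult)
    show "P f" if "linear f" and "\<And>x. f x $ i = 0" for f i
    proof -
      have "\<not> inj f"
        using that by (metis linear_injective_imp_surjective one_neq_zero surjE vec_component)
      then have "det (matrix f) = 0" and "negligible (f ` S)" for S
        using det_nz_iff_inj negligible_linear_singular_image \<open>linear f\<close> by blast+
      then show ?thesis
        by (simp add: P_def negligible_imp_measure0 negligible_imp_measurable)
    qed
    show "P (\<lambda>x. \<chi> i. c i * x $ i)" for c
      by (simp add: P_def measurable_stretch measure_stretch axis_def matrix_def det_diagonal)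
    show "P (\<lambda>x. \<chi> i. x $ Transposition.transpose m n i)" for m n
      by (simp add: P_def measure_swap_coordinates_image det_matrix_swap_coordinates)
    show "P (\<lambda>x. \<chi> i. if i = m then x $ m + x $ n else x $ i)" if "m \<noteq> n" for m n
      using measure_shear_image[OF that] det_matrix_shear[OF that] by (simp add: P_def)
  qed
  with \<open>S \<in> lmeasurable\<close> show "f ` S \<in> lmeasurable"
    and "measure lebesgue (f ` S) = \<bar>det (matrix f)\<bar> * measure lebesgue S"
    unfolding P_def by blast+
qed

lemma lborel_eq_density_distr_matrix:
  fixes A :: "real^'n::finite^'n"
  assumes "invertible A"
  shows "lborel = density (distr lborel borel ((*v) A)) (\<lambda>_. ennreal \<bar>det A\<bar>)"
proof (rule lborel_eqI)
  fix l u :: "real^'n"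
  assume le: "\<And>b. b \<in> Basis \<Longrightarrow> l \<bullet> b \<le> u \<bullet> b"
  obtain B where AB: "A ** B = mat 1" "B ** A = mat 1"
    using assms unfolding invertible_def by blast
  have det: "\<bar>det A\<bar> * \<bar>det B\<bar> = 1"
    using AB(1) by (metis abs_1 abs_mult det_I det_mul)
  have [measurable]: "(*v) A \<in> borel \<rightarrow>\<^sub>M borel"
    by (intro borel_measurable_continuous_onI linear_continuous_on matrix_vector_mul_bounded_linear)
  then have [measurable]: "(*v) A -` box l u \<in> sets borel"
    using measurable_sets[of "(*v) A" borel borel "box l u"] by simp
  have pre: "(*v) A -` box l u = (*v) B ` box l u"
  proof (intro set_eqI iffI)
    fix x assume "x \<in> (*v) A -` box l u"
    moreover have "x = B *v (A *v x)" by (simp add: matrix_vector_mul_assoc AB)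
    ultimately show "x \<in> (*v) B ` box l u" by blast
  qed (auto simp: matrix_vector_mul_assoc AB)
  have "emeasure lborel ((*v) A -` box l u) = emeasure lebesgue ((*v) B ` box l u)"
    by (simp flip: pre add: emeasure_completion)
  also have "\<dots> = ennreal (\<bar>det B\<bar> * measure lebesgue (box l u))"
    using lmeasurable_linear_image_gen[of "(*v) B" "box l u"] measure_linear_image_gen[of "(*v) B" "box l u"]
    by (simp add: emeasure_eq_measure2 matrix_vector_mul_linear matrix_of_matrix_vector_mul)
  finally have "emeasure (density (distr lborel borel ((*v) A)) (\<lambda>_. ennreal \<bar>det A\<bar>)) (box l u)
      = ennreal \<bar>det A\<bar> * ennreal (\<bar>det B\<bar> * measure lebesgue (box l u))"
    by (simp add: emeasure_density emeasure_distr nn_integral_cmult_indicator)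
  also have "\<dots> = ennreal (measure lebesgue (box l u))"
    by (simp flip: ennreal_mult add: mult.assoc[symmetric] det)
  finally show "emeasure (density (distr lborel borel ((*v) A)) (\<lambda>_. ennreal \<bar>det A\<bar>)) (box l u)
      = (\<Prod>b\<in>Basis. (u - l) \<bullet> b)"
    using le by (simp add: measure_lborel_box_eq measure_completion prod_nonneg inner_diff_left)
qed simp

section \<open>Half-space moments of the standard Gaussian\<close>

definition halfline :: "bool \<Rightarrow> real set" where
  "halfline b = (if b then {0<..} else {..0})"

lemma halfline_sets [measurable]: "halfline b \<in> sets borel"
  by (simp add: halfline_def)

lemma integral_even_halfline:
  fixes g :: "real \<Rightarrow> real"
  assumes int: "integrable lborel g" and even: "\<And>t. g (- t) = g t"
  shows "integrable lborel (\<lambda>t. g t * indicator (halfline b) t)"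
    and "(\<integral>t. g t * indicator (halfline b) t \<partial>lborel) = (\<integral>t. g t \<partial>lborel) / 2"
proof -
  have [measurable]: "g \<in> borel_measurable borel"
    using int by auto
  have int_half: "integrable lborel (\<lambda>t. g t * indicator H t)" if "H \<in> sets borel" for H
    using that int by (intro integrable_real_mult_indicator) auto
  then show "integrable lborel (\<lambda>t. g t * indicator (halfline b) t)"
    by simp
  have "(\<integral>t. g t * indicator {0<..} t \<partial>lborel) = (\<integral>t. g (- t) * indicator {0<..} (- t) \<partial>lborel)"
    using lborel_integral_real_affine[of "-1" "\<lambda>t. g t * indicator {0<..} t" 0] by simp
  also have "\<dots> = (\<integral>t. g t * indicator {..0} t \<partial>lborel)"
    using AE_lborel_singleton[of 0] even
    by (intro integral_cong_AE) (auto split: split_indicator)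
  finally have sym: "(\<integral>t. g t * indicator {0<..} t \<partial>lborel) = (\<integral>t. g t * indicator {..0} t \<partial>lborel)" .
  have "(\<integral>t. g t \<partial>lborel) = (\<integral>t. g t * indicator {0<..} t + g t * indicator {..0} t \<partial>lborel)"
    by (intro Bochner_Integration.integral_cong) (auto split: split_indicator)
  also have "\<dots> = (\<integral>t. g t * indicator {0<..} t \<partial>lborel) + (\<integral>t. g t * indicator {..0} t \<partial>lborel)"
    by (intro Bochner_Integration.integral_add int_half) auto
  finally show "(\<integral>t. g t * indicator (halfline b) t \<partial>lborel) = (\<integral>t. g t \<partial>lborel) / 2"
    using sym by (simp add: halfline_def)
qed

lemma std_normal_moments:
  assumes "p \<le> 2"
  shows "(\<integral>t. std_normal_density t * t ^ p \<partial>lborel) = (if p = 1 then 0 else 1)"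
  using assms integral_std_normal_moment_odd[of 0] integral_std_normal_moment_even[of 1]
  by (auto simp: le_Suc_eq numeral_2_eq_2)

lemma std_normal_halfline_moments:
  assumes "p \<le> 2"
  shows "integrable lborel (\<lambda>t. std_normal_density t * t ^ p * indicator (halfline b) t)"
    and "(\<integral>t. std_normal_density t * t ^ p * indicator (halfline b) t \<partial>lborel)
           = (if p = 1 then (if b then 1 else -1) / sqrt (2 * pi) else 1 / 2)" (is "?I = _")
proof -
  have even: "std_normal_density (- t) = std_normal_density t" for t
    by (simp add: normal_density_def)
  show "integrable lborel (\<lambda>t. std_normal_density t * t ^ p * indicator (halfline b) t)"
    by (intro integrable_real_mult_indicator integrable_std_normal_moment) simp
  show "?I = (if p = 1 then (if b then 1 else -1) / sqrt (2 * pi) else 1 / 2)"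
  proof (cases "p = 1")
    case True
    \<comment> \<open>On \<open>halfline b\<close> the identity \<open>t\<close> is \<open>\<plusminus>\<bar>t\<bar>\<close>, and \<open>\<bar>t\<bar>\<close> is even.\<close>
    have "std_normal_density t * t ^ p * indicator (halfline b) t
        = (if b then 1 else -1) * (std_normal_density t * \<bar>t\<bar> ^ 1 * indicator (halfline b) t)" for t
      using True by (auto simp: halfline_def split: split_indicator)
    then have "?I = (if b then 1 else -1) * (\<integral>t. std_normal_density t * \<bar>t\<bar> ^ 1 * indicator (halfline b) t \<partial>lborel)"
      by (simp only: integral_mult_right_zero)
    also have "\<dots> = (if b then 1 else -1) * (sqrt (2 / pi) / 2)"
      using integral_even_halfline(2)[OF integrable_std_normal_moment_abs, of 1]
        integral_std_normal_moment_abs_odd[of 0] even by simp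
    also have "sqrt (2 / pi) / 2 = 1 / sqrt (2 * pi)"
      by (simp add: real_sqrt_divide real_sqrt_mult field_simps)
    finally show ?thesis
      using True by simp
  next
    case False
    then have "?I = 1 / 2"
      using integral_even_halfline(2)[OF integrable_std_normal_moment, of p] std_normal_moments[OF assms]
        even assms by (auto simp: le_Suc_eq numeral_2_eq_2)
    then show ?thesis
      using False by simp
  qed
qed

lemma integral_lborel_prod_Basis:
  fixes f :: "'a::euclidean_space \<Rightarrow> real \<Rightarrow> real"
  assumes int: "\<And>b. b \<in> Basis \<Longrightarrow> integrable lborel (f b)"
  shows "integrable lborel (\<lambda>x::'a. \<Prod>b\<in>Basis. f b (x \<bullet> b))"
    and "(\<integral>x. (\<Prod>b\<in>Basis. f b (x \<bullet> b)) \<partial>lborel) = (\<Prod>b\<in>Basis. \<integral>t. f b t \<partial>lborel)"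
proof -
  interpret product_sigma_finite "\<lambda>_::'a. lborel :: real measure"
    by standard
  define T where "T g = (\<Sum>b\<in>Basis. g b *\<^sub>R b)" for g :: "'a \<Rightarrow> real"
  have [measurable]: "T \<in> (\<Pi>\<^sub>M b\<in>Basis. lborel) \<rightarrow>\<^sub>M borel"
    unfolding T_def by measurable
  have [measurable]: "f b \<in> borel_measurable borel" if "b \<in> Basis" for b
    using int[OF that] by auto
  have T_inner: "T g \<bullet> b = g b" if "b \<in> Basis" for g b
    using that by (simp add: T_def inner_sum_left inner_Basis if_distrib cong: if_cong)
  have lborel: "lborel = distr (\<Pi>\<^sub>M b\<in>Basis. lborel) borel T"
    unfolding T_def by (rule lborel_eq)
  have prod_T: "(\<Prod>b\<in>Basis. f b (T g \<bullet> b)) = (\<Prod>b\<in>Basis. f b (g b))" for g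
    by (intro prod.cong) (simp_all add: T_inner)
  have "integrable (\<Pi>\<^sub>M b\<in>Basis. lborel) (\<lambda>g. \<Prod>b\<in>Basis. f b (g b))"
    by (intro product_integrable_prod int) auto
  then show "integrable lborel (\<lambda>x::'a. \<Prod>b\<in>Basis. f b (x \<bullet> b))"
    by (subst lborel, subst integrable_distr_eq) (simp_all add: prod_T)
  have "(\<integral>x. (\<Prod>b\<in>Basis. f b (x \<bullet> b)) \<partial>lborel)
      = (\<integral>g. (\<Prod>b\<in>Basis. f b (g b)) \<partial>(\<Pi>\<^sub>M b\<in>Basis. lborel))"
    by (subst lborel, subst integral_distr) (simp_all add: prod_T)
  also have "\<dots> = (\<Prod>b\<in>Basis. \<integral>t. f b t \<partial>lborel)"
    by (intro product_integral_prod int) auto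
  finally show "(\<integral>x. (\<Prod>b\<in>Basis. f b (x \<bullet> b)) \<partial>lborel) = (\<Prod>b\<in>Basis. \<integral>t. f b t \<partial>lborel)" .
qed

lemma integral_lborel_prod_coordinates:
  fixes g :: "'n::finite \<Rightarrow> real \<Rightarrow> real"
  assumes int: "\<And>i. integrable lborel (g i)"
  shows "integrable lborel (\<lambda>y::real^'n. \<Prod>i\<in>UNIV. g i (y $ i))"
    and "(\<integral>y. (\<Prod>i\<in>UNIV. g i (y $ i)) \<partial>(lborel :: (real^'n) measure)) = (\<Prod>i\<in>UNIV. \<integral>t. g i t \<partial>lborel)"
proof -
  define f where "f b = g (SOME i. b = axis i 1)" for b :: "real^'n"
  have f_axis: "f (axis i 1) = g i" for i
    unfolding f_def by (rule arg_cong[of _ _ g], rule some_equality) (auto simp: axis_eq_axis)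
  have inj: "inj (\<lambda>i::'n. axis i (1::real))"
    by (auto simp: inj_def axis_eq_axis)
  have Basis: "(Basis :: (real^'n) set) = range (\<lambda>i. axis i 1)"
    by (auto simp: Basis_vec_def)
  have prod_Basis: "(\<Prod>b\<in>Basis. h b) = (\<Prod>i\<in>UNIV. h (axis i 1))" for h :: "real^'n \<Rightarrow> real"
    unfolding Basis by (simp add: prod.reindex[OF inj])
  have "integrable lborel (f b)" if "b \<in> Basis" for b
    using that int by (auto simp: Basis f_axis)
  note prod = integral_lborel_prod_Basis[of f, OF this]
  show "integrable lborel (\<lambda>y::real^'n. \<Prod>i\<in>UNIV. g i (y $ i))"
    using prod(1) by (simp add: prod_Basis f_axis inner_axis)
  show "(\<integral>y. (\<Prod>i\<in>UNIV. g i (y $ i)) \<partial>(lborel :: (real^'n) measure)) = (\<Prod>i\<in>UNIV. \<integral>t. g i t \<partial>lborel)"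
    using prod(2) by (simp add: prod_Basis f_axis inner_axis)
qed

definition std_normal_density_vec :: "real^'n::finite \<Rightarrow> real" where
  "std_normal_density_vec y = (\<Prod>i\<in>UNIV. std_normal_density (y $ i))"

lemma std_normal_density_vec_nonneg: "0 \<le> std_normal_density_vec y"
  by (simp add: std_normal_density_vec_def prod_nonneg)

lemma std_normal_density_vec_measurable [measurable]: "std_normal_density_vec \<in> borel_measurable borel"
  unfolding std_normal_density_vec_def[abs_def] by measurable

lemma std_normal_density_vec_eq:
  "std_normal_density_vec (y :: real^'n::finite) = exp (- (y \<bullet> y) / 2) / sqrt (2 * pi) ^ CARD('n)"
  by (simp add: std_normal_density_vec_def std_normal_density_def inner_vec_def power2_eq_square
      prod_dividef exp_sum[symmetric] sum_negf sum_divide_distrib[symmetric])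

lemma std_normal_vec_monomial_halfspace:
  fixes p :: "'n::finite \<Rightarrow> nat" and j :: 'n and b :: bool
  defines "m y \<equiv> std_normal_density_vec y * (\<Prod>i\<in>UNIV. (y $ i) ^ p i) * indicator (halfline b) (y $ j)"
  assumes p: "\<And>i. p i \<le> 2"
  shows "integrable lborel m"
    and "(\<integral>y. m y \<partial>lborel) = (if p j = 1 then (if b then 1 else -1) / sqrt (2 * pi) else 1 / 2)
                           * (if \<exists>i\<noteq>j. p i = 1 then 0 else 1)" (is "_ = ?v")
proof -
  define g where "g i t = std_normal_density t * t ^ p i * (if i = j then indicator (halfline b) t else 1)" for i t
  have int: "integrable lborel (g i)" for i
    unfolding g_def using std_normal_halfline_moments(1)[of 0 b] integrable_std_normal_moment
    by (cases "i = j") (auto intro!: integrable_real_mult_indicator)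
  have "(\<Prod>i\<in>UNIV. g i (y $ i)) = m y" for y
    by (simp add: g_def m_def std_normal_density_vec_def prod.distrib prod.If_cases Compl_eq_Diff_UNIV)
  then have m: "m = (\<lambda>y. \<Prod>i\<in>UNIV. g i (y $ i))"
    by auto
  show "integrable lborel m"
    unfolding m by (rule integral_lborel_prod_coordinates(1)[OF int])
  have "(\<integral>y. m y \<partial>lborel) = (\<Prod>i\<in>UNIV. \<integral>t. g i t \<partial>lborel)"
    unfolding m by (rule integral_lborel_prod_coordinates(2)[OF int])
  also have "\<dots> = (\<integral>t. g j t \<partial>lborel) * (\<Prod>i\<in>-{j}. \<integral>t. g i t \<partial>lborel)"
    by (simp add: prod.remove[of UNIV j] Compl_eq_Diff_UNIV)
  also have "\<dots> = (if p j = 1 then (if b then 1 else -1) / sqrt (2 * pi) else 1 / 2)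
                  * (\<Prod>i\<in>-{j}. if p i = 1 then 0 else 1)"
    by (simp add: g_def std_normal_halfline_moments(2)[OF p] std_normal_moments[OF p])
  also have "(\<Prod>i\<in>-{j}. if p i = 1 then 0 else 1 :: real) = (if \<exists>i\<noteq>j. p i = 1 then 0 else 1)"
    by (cases "\<exists>i\<noteq>j. p i = 1") (auto intro!: prod.neutral prod_zero)
  finally show "(\<integral>y. m y \<partial>lborel) = ?v" .
qed

lemma std_normal_vec_halfspace_moments:
  fixes a c j :: "'n::finite"
  shows "integrable lborel (\<lambda>y. std_normal_density_vec y * indicator (halfline b) (y $ j))" (is ?int0)
    and "(\<integral>y. std_normal_density_vec y * indicator (halfline b) (y $ j) \<partial>lborel) = 1 / 2" (is ?mom0)
    and "integrable lborel (\<lambda>y. std_normal_density_vec y * y $ a * indicator (halfline b) (y $ j))"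
      (is ?int1)
    and "(\<integral>y. std_normal_density_vec y * y $ a * indicator (halfline b) (y $ j) \<partial>lborel)
           = (if a = j then (if b then 1 else -1) / sqrt (2 * pi) else 0)" (is ?mom1)
    and "integrable lborel (\<lambda>y. std_normal_density_vec y * (y $ a * y $ c) * indicator (halfline b) (y $ j))"
      (is ?int2)
    and "(\<integral>y. std_normal_density_vec y * (y $ a * y $ c) * indicator (halfline b) (y $ j) \<partial>lborel)
           = (if a = c then 1 / 2 else 0)" (is ?mom2)
proof -
  note zero = std_normal_vec_monomial_halfspace[where p = "\<lambda>_. 0" and j = j and b = b]
  show ?int0 and ?mom0
    using zero by simp_all
  have mono1: "(\<Prod>i\<in>UNIV. (y $ i) ^ of_bool (i = k)) = y $ k" for y :: "real^'n" and k
    by (subst prod.remove[of UNIV k]) auto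
  note one = std_normal_vec_monomial_halfspace[where p = "\<lambda>i. of_bool (i = a)" and j = j and b = b,
    unfolded mono1]
  show ?int1 and ?mom1
    using one by auto
  have mono2: "(\<Prod>i\<in>UNIV. (y $ i) ^ (of_bool (i = a) + of_bool (i = c))) = y $ a * y $ c" for y :: "real^'n"
    by (simp add: power_add prod.distrib mono1)
  note two = std_normal_vec_monomial_halfspace[where p = "\<lambda>i. of_bool (i = a) + of_bool (i = c)" and j = j
    and b = b, unfolded mono2]
  show ?int2 and ?mom2
    using two by auto
qed

lemma std_normal_vec_halfspace_inner_moments:
  fixes u w :: "real^'n::finite" and j :: 'n
  shows "integrable lborel (\<lambda>y. std_normal_density_vec y * (u \<bullet> y) * indicator (halfline b) (y $ j))"
      (is ?int1)
    and "(\<integral>y. std_normal_density_vec y * (u \<bullet> y) * indicator (halfline b) (y $ j) \<partial>lborel)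
           = u $ j * (if b then 1 else -1) / sqrt (2 * pi)" (is ?mom1)
    and "integrable lborel (\<lambda>y. std_normal_density_vec y * ((u \<bullet> y) * (w \<bullet> y)) * indicator (halfline b) (y $ j))"
      (is ?int2)
    and "(\<integral>y. std_normal_density_vec y * ((u \<bullet> y) * (w \<bullet> y)) * indicator (halfline b) (y $ j) \<partial>lborel)
           = (u \<bullet> w) / 2" (is ?mom2)
proof -
  note mom = std_normal_vec_halfspace_moments[where b = b and j = j]
  have lin: "std_normal_density_vec y * (u \<bullet> y) * indicator (halfline b) (y $ j)
      = (\<Sum>a\<in>UNIV. u $ a * (std_normal_density_vec y * y $ a * indicator (halfline b) (y $ j)))" for y
    by (simp add: inner_vec_def sum_distrib_left sum_distrib_right mult_ac)
  have quad: "std_normal_density_vec y * ((u \<bullet> y) * (w \<bullet> y)) * indicator (halfline b) (y $ j)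
      = (\<Sum>c\<in>UNIV. \<Sum>a\<in>UNIV. u $ a * w $ c *
           (std_normal_density_vec y * (y $ a * y $ c) * indicator (halfline b) (y $ j)))" for y
    by (simp add: inner_vec_def sum_product sum_distrib_left sum_distrib_right mult_ac)
  show ?int1 and ?int2
    unfolding lin quad using mom by auto
  show ?mom1
    unfolding lin by (simp add: mom if_distrib sum.delta cong: if_cong)
  show ?mom2
    unfolding quad
    by (simp add: mom if_distrib sum.delta inner_vec_def sum_divide_distrib cong: if_cong)
qed

section \<open>Factorisations of positive definite matrices\<close>

definition sym_posdef :: "real^'n^'n \<Rightarrow> bool" where
  "sym_posdef S \<longleftrightarrow> transpose S = S \<and> (\<forall>x. x \<noteq> 0 \<longrightarrow> 0 < x \<bullet> (S *v x))"

lemma sym_posdef_inner_commute: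
  assumes "sym_posdef S"
  shows "x \<bullet> (S *v y) = y \<bullet> (S *v x)"
proof -
  have "x \<bullet> (S *v y) = (x v* S) \<bullet> y"
    by (simp add: dot_lmul_matrix)
  also have "x v* S = S *v x"
    using assms by (metis sym_posdef_def vector_transpose_matrix)
  finally show ?thesis
    by (simp add: inner_commute)
qed

lemma sym_posdef_nonneg:
  assumes "sym_posdef S"
  shows "0 \<le> quad S x"
  using assms by (cases "x = 0") (auto simp: sym_posdef_def quad_def intro: less_imp_le)

lemma sym_posdef_invertible:
  assumes "sym_posdef S"
  shows "invertible S"
proof -
  have "inj ((*v) S)"
  proof (rule injI)
    fix x y
    assume "S *v x = S *v y"
    then have "(x - y) \<bullet> (S *v (x - y)) = 0"
      by (simp add: matrix_vector_mult_diff_distrib)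
    then show "x = y"
      using assms by (metis less_irrefl right_minus_eq sym_posdef_def)
  qed
  then show ?thesis
    by (simp add: invertible_left_inverse matrix_left_invertible_injective)
qed

lemma sym_posdef_cauchy_schwarz:
  assumes "sym_posdef S"
  shows "(x \<bullet> (S *v y))\<^sup>2 \<le> quad S x * quad S y"
proof (cases "y = 0")
  case False
  define c where "c = quad S y"
  have "c > 0"
    using assms False by (simp add: c_def quad_def sym_posdef_def)
  define t where "t = (x \<bullet> (S *v y)) / c"
  have "0 \<le> quad S (x - t *\<^sub>R y)"
    by (rule sym_posdef_nonneg[OF assms])
  also have "\<dots> = quad S x - 2 * t * (x \<bullet> (S *v y)) + t\<^sup>2 * c"
    using sym_posdef_inner_commute[OF assms, of y x]
    by (simp add: quad_def matrix_vector_mult_diff_distrib matrix_vector_mult_scaleR inner_diff_left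
        inner_diff_right algebra_simps c_def power2_eq_square)
  also have "\<dots> = quad S x - (x \<bullet> (S *v y))\<^sup>2 / c"
    using \<open>c > 0\<close> by (simp add: t_def power2_eq_square field_simps)
  finally show ?thesis
    using \<open>c > 0\<close> by (simp add: c_def field_simps)
qed (simp add: quad_def)

definition orthonormal_wrt :: "real^'n^'n \<Rightarrow> (real^'n) set \<Rightarrow> bool" where
  "orthonormal_wrt S C \<longleftrightarrow> (\<forall>c\<in>C. \<forall>c'\<in>C. c \<bullet> (S *v c') = (if c = c' then 1 else 0))"

lemma orthonormal_wrt_extend:
  fixes S :: "real^'n::finite^'n"
  assumes S: "sym_posdef S" and "finite C0" and "orthonormal_wrt S C0"
  shows "\<exists>C. finite C \<and> orthonormal_wrt S C \<and> C0 \<subseteq> C \<and> span C = UNIV"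
proof -
  have "\<exists>C. finite C \<and> orthonormal_wrt S C \<and> C0 \<subseteq> C \<and> B \<subseteq> span C" if "finite B" for B
    using that
  proof (induction B rule: finite_induct)
    case empty
    then show ?case
      using assms by blast
  next
    case (insert b B)
    then obtain C where C: "finite C" "orthonormal_wrt S C" "C0 \<subseteq> C" "B \<subseteq> span C"
      by blast
    show ?case
    proof (cases "b \<in> span C")
      case True
      then show ?thesis
        using C by blast
    next
      case False
      define w where "w = b - (\<Sum>c\<in>C. (b \<bullet> (S *v c)) *\<^sub>R c)"
      have w_orth: "w \<bullet> (S *v c) = 0" if "c \<in> C" for c
      proof -
        have "(\<Sum>c'\<in>C. (b \<bullet> (S *v c')) * (c' \<bullet> (S *v c))) = (\<Sum>c'\<in>C. if c' = c then b \<bullet> (S *v c') else 0)"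
          using C(2) that unfolding orthonormal_wrt_def by (intro sum.cong) auto
        then show ?thesis
          using C(1) that by (simp add: w_def inner_diff_left inner_sum_left)
      qed
      have "w \<noteq> 0"
      proof
        assume "w = 0"
        then have "b = (\<Sum>c\<in>C. (b \<bullet> (S *v c)) *\<^sub>R c)"
          by (simp add: w_def)
        also have "\<dots> \<in> span C"
          by (intro span_sum span_scale span_base)
        finally show False
          using False by simp
      qed
      define s where "s = sqrt (quad S w)"
      have "s > 0"
        using S \<open>w \<noteq> 0\<close> by (simp add: s_def quad_def sym_posdef_def)
      define e where "e = (1 / s) *\<^sub>R w"
      have e_norm: "e \<bullet> (S *v e) = 1"
        using \<open>s > 0\<close> sym_posdef_nonneg[OF S, of w]
        by (simp add: quad_def e_def s_def matrix_vector_mult_scaleR power2_eq_square[symmetric])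
      have e_orth: "e \<bullet> (S *v c) = 0" "c \<bullet> (S *v e) = 0" if "c \<in> C" for c
        using w_orth[OF that] sym_posdef_inner_commute[OF S, of c e] by (simp_all add: e_def)
      have "e \<notin> C"
        using e_norm e_orth by force
      have "b = s *\<^sub>R e + (\<Sum>c\<in>C. (b \<bullet> (S *v c)) *\<^sub>R c)"
        using \<open>s > 0\<close> by (simp add: e_def w_def)
      also have "\<dots> \<in> span (insert e C)"
        by (intro span_add span_sum span_scale span_base) auto
      finally have "b \<in> span (insert e C)" .
      then show ?thesis
        using C e_norm e_orth \<open>e \<notin> C\<close> span_mono[OF subset_insertI, of C e]
        by (intro exI[of _ "insert e C"]) (auto simp: orthonormal_wrt_def)
    qed
  qed
  from this[OF finite_Basis] obtain C
    where "finite C" "orthonormal_wrt S C" "C0 \<subseteq> C" "Basis \<subseteq> span C"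
    by blast
  moreover have "span C = UNIV"
    using \<open>Basis \<subseteq> span C\<close> span_mono[of Basis "span C"] by (auto simp: span_Basis span_span)
  ultimately show ?thesis
    by blast
qed

lemma transpose_mult_mult_entry:
  fixes B S :: "real^'n::finite^'n"
  shows "(transpose B ** S ** B) $ k $ l = column k B \<bullet> (S *v column l B)"
  unfolding matrix_matrix_mult_def matrix_vector_mult_def inner_vec_def column_def transpose_def
  by (simp add: sum_distrib_left sum_distrib_right mult_ac) (subst sum.swap, simp add: mult_ac)

lemma sym_posdef_aligned_factor:
  fixes S :: "real^'n::finite^'n" and r :: "real^'n" and j :: 'n
  assumes S: "sym_posdef S" and "r \<noteq> 0"
  obtains A where "A ** transpose A = S" and "invertible A"
    and "transpose A *v r = sqrt (quad S r) *\<^sub>R axis j 1"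
proof -
  define s where "s = sqrt (quad S r)"
  have "s > 0"
    using S \<open>r \<noteq> 0\<close> by (simp add: s_def quad_def sym_posdef_def)
  define e where "e = (1 / s) *\<^sub>R r"
  have "orthonormal_wrt S {e}"
    using \<open>s > 0\<close> sym_posdef_nonneg[OF S, of r]
    by (simp add: quad_def orthonormal_wrt_def e_def s_def matrix_vector_mult_scaleR power2_eq_square[symmetric])
  then obtain C where C: "finite C" "orthonormal_wrt S C" "e \<in> C" "span C = UNIV"
    using orthonormal_wrt_extend[OF S, of "{e}"] by auto
  have "CARD('n) \<le> card C"
    using span_card_ge_dim[of C UNIV] C by simp
  then have "card (UNIV - {j}) \<le> card (C - {e})"
    using C by (simp add: card_Diff_singleton)
  then obtain f where f: "f ` (UNIV - {j}) \<subseteq> C - {e}" "inj_on f (UNIV - {j})"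
    using card_le_inj[of "UNIV - {j}" "C - {e}"] C(1) by auto
  \<comment> \<open>The columns of \<open>B\<close> form an \<open>S\<close>-orthonormal basis whose \<open>j\<close>-th member is \<open>e\<close>.\<close>
  define g where "g i = (if i = j then e else f i)" for i
  have g: "g i \<in> C" "g i = g k \<longleftrightarrow> i = k" for i k
    using f C(3) by (auto simp: g_def inj_on_def)
  define B where "B = (\<chi> i k. g k $ i)"
  have column_B: "column k B = g k" for k
    by (simp add: B_def column_def vec_eq_iff)
  have BSB: "transpose B ** S ** B = mat 1"
    using C(2) g by (simp add: vec_eq_iff transpose_mult_mult_entry column_B orthonormal_wrt_def mat_def)
  then have BBS: "B ** (transpose B ** S) = mat 1"
    using matrix_left_right_inverse[of "transpose B ** S" B] by simp
  \<comment> \<open>\<open>B B\<^sup>T = S\<^sup>-\<^sup>1\<close>, so \<open>A = S B\<close> satisfies \<open>A A\<^sup>T = S\<close>.\<close>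
  show ?thesis
  proof
    show "(S ** B) ** transpose (S ** B) = S"
      using S BBS by (simp add: sym_posdef_def matrix_transpose_mul)
        (metis matrix_mul_assoc matrix_mul_rid)
    show "invertible (S ** B)"
      using invertible_right_inverse[of B] BBS sym_posdef_invertible[OF S] invertible_mult by blast
    have "r = s *\<^sub>R (B *v axis j 1)"
      using \<open>s > 0\<close> by (simp add: matrix_vector_mult_basis column_B g_def e_def)
    then have "transpose (S ** B) *v r = s *\<^sub>R ((transpose B ** S ** B) *v axis j 1)"
      using S by (simp add: sym_posdef_def matrix_transpose_mul matrix_vector_mult_scaleR
          matrix_vector_mul_assoc del: transpose_matrix_vector)
    then show "transpose (S ** B) *v r = sqrt (quad S r) *\<^sub>R axis j 1"
      by (simp add: BSB s_def del: transpose_matrix_vector)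
  qed
qed

section \<open>Gaussian measures as linear images\<close>

lemma inner_transpose_matrix_vector:
  fixes B :: "real^'n::finite^'m::finite"
  shows "x \<bullet> (transpose B *v y) = (B *v x) \<bullet> y"
  by (metis dot_lmul_matrix vector_transpose_matrix)

definition std_normal_vec :: "(real^'n::finite) measure" where
  "std_normal_vec = density lborel (\<lambda>y. ennreal (std_normal_density_vec y))"

lemma sets_gauss [simp, measurable_cong]: "sets (gauss S) = sets borel"
  by (simp add: gauss_def)

lemma matrix_vector_mult_measurable [measurable]:
  "(*v) (A :: real^'n::finite^'m::finite) \<in> borel_measurable borel"
  by (intro borel_measurable_continuous_onI linear_continuous_on matrix_vector_mul_bounded_linear)

lemma gauss_pdf_measurable [measurable]: "gauss_pdf S \<in> borel_measurable borel"
  unfolding gauss_pdf_def[abs_def] by measurable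

lemma matrix_inv_unique:
  fixes S X :: "real^'n::finite^'n"
  assumes "S ** X = mat 1" and "X ** S = mat 1"
  shows "matrix_inv S = X"
proof -
  have "invertible S"
    using assms unfolding invertible_def by blast
  then have "matrix_inv S ** S = mat 1"
    unfolding invertible_def matrix_inv_def by (metis (mono_tags, lifting) someI_ex)
  then show ?thesis
    using assms(1) by (metis matrix_mul_assoc matrix_mul_lid matrix_mul_rid)
qed

lemma gauss_pdf_factor:
  fixes A S :: "real^'n::finite^'n"
  assumes AA: "A ** transpose A = S" and A: "invertible A"
  shows "gauss_pdf S (A *v y) * \<bar>det A\<bar> = std_normal_density_vec y"
proof -
  obtain A' where A': "A ** A' = mat 1" "A' ** A = mat 1"
    using A unfolding invertible_def by blast
  have "S ** (transpose A' ** A') = mat 1" "(transpose A' ** A') ** S = mat 1"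
    using A' unfolding AA[symmetric]
    by (metis matrix_mul_assoc matrix_mul_lid matrix_mul_rid matrix_transpose_mul transpose_mat)+
  then have "matrix_inv S = transpose A' ** A'"
    by (rule matrix_inv_unique)
  then have "matrix_inv S *v (A *v y) = transpose A' *v (A' *v (A *v y))"
    by (simp add: matrix_vector_mul_assoc matrix_mul_assoc del: transpose_matrix_vector)
  also have "A' *v (A *v y) = y"
    using A' by (simp add: matrix_vector_mul_assoc)
  finally have "matrix_inv S *v (A *v y) = transpose A' *v y" .
  then have quad_form: "(A *v y) \<bullet> (matrix_inv S *v (A *v y)) = y \<bullet> y"
    using A' by (simp add: inner_transpose_matrix_vector matrix_vector_mul_assoc del: transpose_matrix_vector)
  have "det S = (det A)\<^sup>2"
    unfolding AA[symmetric] by (simp add: det_mul power2_eq_square)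
  then have "sqrt (det S) = \<bar>det A\<bar>"
    by simp
  then have "sqrt ((2 * pi) ^ CARD('n) * det S) = sqrt (2 * pi) ^ CARD('n) * \<bar>det A\<bar>"
    by (simp only: real_sqrt_mult real_sqrt_power)
  moreover have "det A \<noteq> 0"
    using A invertible_det_nz by blast
  ultimately show ?thesis
    by (simp add: gauss_pdf_def quad_form std_normal_density_vec_eq)
qed

lemma gauss_eq_distr_std_normal_vec:
  fixes A S :: "real^'n::finite^'n"
  assumes AA: "A ** transpose A = S" and A: "invertible A"
  shows "gauss S = distr std_normal_vec borel ((*v) A)"
proof (rule measure_eqI)
  fix X
  assume "X \<in> sets (gauss S)"
  then have [measurable]: "X \<in> sets borel"
    by simp
  have [measurable]: "(*v) A -` X \<in> sets borel"
    using measurable_sets[of "(*v) A" borel borel X] by simp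
  have "emeasure (gauss S) X = (\<integral>\<^sup>+x. ennreal (gauss_pdf S x) * indicator X x \<partial>lborel)"
    by (simp add: gauss_def emeasure_density)
  also have "\<dots> = (\<integral>\<^sup>+y. ennreal \<bar>det A\<bar> * (ennreal (gauss_pdf S (A *v y)) * indicator X (A *v y)) \<partial>lborel)"
    by (subst lborel_eq_density_distr_matrix[OF A]) (simp add: nn_integral_density nn_integral_distr)
  also have "\<dots> = (\<integral>\<^sup>+y. ennreal (std_normal_density_vec y) * indicator ((*v) A -` X) y \<partial>lborel)"
    using gauss_pdf_factor[OF AA A]
    by (intro nn_integral_cong)
      (simp add: mult.assoc[symmetric] mult.commute split: split_indicator flip: ennreal_mult')
  also have "\<dots> = emeasure (distr std_normal_vec borel ((*v) A)) X"
    by (simp add: std_normal_vec_def emeasure_distr emeasure_density)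
  finally show "emeasure (gauss S) X = emeasure (distr std_normal_vec borel ((*v) A)) X" .
qed (simp add: std_normal_vec_def)

lemma
  fixes A S :: "real^'n::finite^'n" and f :: "real^'n \<Rightarrow> real"
  assumes "A ** transpose A = S" and "invertible A" and [measurable]: "f \<in> borel_measurable borel"
  shows integrable_gauss_iff: "integrable (gauss S) f \<longleftrightarrow>
           integrable lborel (\<lambda>y. std_normal_density_vec y * f (A *v y))"
    and integral_gauss_eq: "(\<integral>x. f x \<partial>gauss S) = (\<integral>y. std_normal_density_vec y * f (A *v y) \<partial>lborel)"
  unfolding gauss_eq_distr_std_normal_vec[OF assms(1,2)] std_normal_vec_def
  by (simp_all add: integrable_distr_eq integrable_density integral_distr integral_density
      std_normal_density_vec_nonneg)

lemma gauss_halfspace: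
  fixes A S :: "real^'n::finite^'n" and r :: "real^'n" and f :: "real^'n \<Rightarrow> real" and b :: bool
  assumes AA: "A ** transpose A = S" and A: "invertible A"
    and Ar: "transpose A *v r = c *\<^sub>R axis j 1" and "0 < c"
    and [measurable]: "f \<in> borel_measurable borel"
  defines "M \<equiv> uniform_measure (gauss S) {x. r \<bullet> x \<in> halfline b}"
  shows "prob_space M"
    and "integrable M f \<longleftrightarrow> integrable lborel
           (\<lambda>y. std_normal_density_vec y * (2 * f (A *v y)) * indicator (halfline b) (y $ j))" (is ?int)
    and "(\<integral>x. f x \<partial>M)
           = (\<integral>y. std_normal_density_vec y * (2 * f (A *v y)) * indicator (halfline b) (y $ j) \<partial>lborel)"
      (is ?integral)
proof -
  define H where "H = {x. r \<bullet> x \<in> halfline b}"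
  have [measurable]: "H \<in> sets borel"
    unfolding H_def by measurable
  have [measurable]: "(*v) A -` H \<in> sets borel"
    using measurable_sets[of "(*v) A" borel borel H] by simp
  \<comment> \<open>In the coordinates \<open>y = A\<^sup>-\<^sup>1 x\<close> the half-space is a coordinate half-space.\<close>
  have "r \<bullet> (A *v y) = c * y $ j" for y
    using Ar by (simp add: inner_commute[of r] flip: inner_transpose_matrix_vector)
      (simp add: inner_axis del: transpose_matrix_vector)
  then have ind: "indicator H (A *v y) = (indicator (halfline b) (y $ j) :: real)" for y
    using \<open>0 < c\<close> by (simp add: H_def halfline_def zero_less_mult_iff mult_le_0_iff split: split_indicator)
  have "emeasure (gauss S) H = (\<integral>\<^sup>+y. ennreal (std_normal_density_vec y * indicator (halfline b) (y $ j)) \<partial>lborel)"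
    unfolding gauss_eq_distr_std_normal_vec[OF AA A] std_normal_vec_def
    by (auto simp: emeasure_distr emeasure_density ind[symmetric] intro!: nn_integral_cong split: split_indicator)
  also have "\<dots> = ennreal (1 / 2)"
    using std_normal_vec_halfspace_moments(1)[of b j]
    by (subst nn_integral_eq_integral)
      (simp_all add: std_normal_density_vec_nonneg std_normal_vec_halfspace_moments(2))
  finally have H_half: "emeasure (gauss S) H = ennreal (1 / 2)" .
  then show "prob_space M"
    unfolding M_def H_def[symmetric] by (intro prob_space_uniform_measure) simp_all
  have "(1 :: ennreal) / ennreal (1 / 2) = ennreal 2"
    using divide_ennreal[of 1 "1 / 2"] by simp
  then have "M = density (gauss S) (\<lambda>x. ennreal (2 * indicator H x))"
    unfolding M_def H_def[symmetric] uniform_measure_def H_half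
    by (intro arg_cong[where f = "density (gauss S)"] ext) (auto split: split_indicator)
  then show ?int and ?integral
    by (simp_all add: integrable_density integral_density integrable_gauss_iff[OF AA A]
        integral_gauss_eq[OF AA A] ind mult_ac)
qed

lemma gauss_halfspace_moments:
  fixes S :: "real^'n::finite^'n" and r v w :: "real^'n" and b :: bool
  assumes S: "sym_posdef S" and "r \<noteq> 0"
  defines "M \<equiv> uniform_measure (gauss S) {x. r \<bullet> x \<in> halfline b}"
  shows "prob_space M"
    and "integrable M (\<lambda>x. (v \<bullet> x) * (w \<bullet> x))" (is ?int2)
    and "(\<integral>x. (v \<bullet> x) * (w \<bullet> x) \<partial>M) = v \<bullet> (S *v w)" (is ?mom2)
    and "integrable M (\<lambda>x. v \<bullet> x)" (is ?int1)
    and "(\<integral>x. v \<bullet> x \<partial>M) = (if b then 1 else -1) * sqrt (2 / pi) * (v \<bullet> (S *v r)) / sqrt (quad S r)"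
      (is ?mom1)
proof -
  fix j :: 'n
  define c where "c = sqrt (quad S r)"
  have "c > 0"
    using S \<open>r \<noteq> 0\<close> by (simp add: c_def quad_def sym_posdef_def)
  obtain A where AA: "A ** transpose A = S" and A: "invertible A" and Ar: "transpose A *v r = c *\<^sub>R axis j 1"
    using sym_posdef_aligned_factor[OF S \<open>r \<noteq> 0\<close>, of j] unfolding c_def by blast
  note G = gauss_halfspace[OF AA A Ar \<open>c > 0\<close>, where b = b, folded M_def]
  show "prob_space M"
    using G(1)[where f = "\<lambda>_. 0"] by simp
  define u where "u x = transpose A *v x" for x
  have inner_A: "x \<bullet> (A *v y) = u x \<bullet> y" for x y
    by (simp add: u_def dot_lmul_matrix[symmetric])
  have u_inner: "u x \<bullet> u x' = x \<bullet> (S *v x')" for x x'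
  proof -
    have "u x \<bullet> u x' = x \<bullet> (A *v u x')"
      by (simp add: inner_A)
    also have "\<dots> = x \<bullet> (S *v x')"
      by (simp add: u_def matrix_vector_mul_assoc AA del: transpose_matrix_vector)
    finally show ?thesis .
  qed
  note mom = std_normal_vec_halfspace_inner_moments[where b = b and j = j]
  have "(\<lambda>y. std_normal_density_vec y * (2 * ((v \<bullet> (A *v y)) * (w \<bullet> (A *v y)))) * indicator (halfline b) (y $ j))
      = (\<lambda>y. 2 * (std_normal_density_vec y * ((u v \<bullet> y) * (u w \<bullet> y)) * indicator (halfline b) (y $ j)))"
    by (simp add: inner_A mult_ac)
  then show ?int2 and ?mom2
    using mom(3,4)[of "u v" "u w"] by (simp_all add: G u_inner)
  have "u v $ j = u v \<bullet> u r / c"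
    using \<open>c > 0\<close> by (simp add: u_def Ar inner_axis del: transpose_matrix_vector)
  moreover have "sqrt (2 / pi) = 2 / sqrt (2 * pi)"
    by (simp add: real_sqrt_divide real_sqrt_mult field_simps)
  ultimately have "2 * (u v $ j / sqrt (2 * pi)) = sqrt (2 / pi) * (v \<bullet> (S *v r)) / c"
    by (simp add: u_inner)
  moreover have "(\<lambda>y. std_normal_density_vec y * (2 * (v \<bullet> (A *v y))) * indicator (halfline b) (y $ j))
      = (\<lambda>y. 2 * (std_normal_density_vec y * (u v \<bullet> y) * indicator (halfline b) (y $ j)))"
    by (simp add: inner_A mult_ac)
  ultimately show ?int1 and ?mom1
    using mom(1,2)[of "u v"] by (simp_all add: G c_def)
qed

section \<open>Bags drawn from two classes with opposite means\<close>

lemma integral_uniform_count_measure_pair: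
  fixes N :: "'b measure" and A :: "'a set" and F :: "'a \<times> 'b \<Rightarrow> real"
  assumes A: "finite A" "A \<noteq> {}" and N: "sigma_finite_measure N"
    and F: "\<And>a. a \<in> A \<Longrightarrow> integrable N (\<lambda>y. F (a, y))"
  shows "integrable (uniform_count_measure A \<Otimes>\<^sub>M N) F"
    and "(\<integral>z. F z \<partial>(uniform_count_measure A \<Otimes>\<^sub>M N)) = (\<Sum>a\<in>A. \<integral>y. F (a, y) \<partial>N) / card A"
proof -
  interpret U: prob_space "uniform_count_measure A"
    using A by (rule prob_space_uniform_count_measure)
  interpret N: sigma_finite_measure N
    by (rule N)
  interpret pair_sigma_finite "uniform_count_measure A" N ..
  have "F \<in> borel_measurable (count_space A \<Otimes>\<^sub>M N)"
    using A(1) F by (intro measurable_pair_measure_countable1) (auto intro: countable_finite)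
  then have [measurable]: "F \<in> borel_measurable (uniform_count_measure A \<Otimes>\<^sub>M N)"
    by (simp add: measurable_def space_pair_measure sets_pair_measure space_uniform_count_measure
        sets_uniform_count_measure_count_space)
  have "(\<integral>\<^sup>+z. ennreal (norm (F z)) \<partial>(uniform_count_measure A \<Otimes>\<^sub>M N))
      = (\<Sum>a\<in>A. ennreal (1 / card A) * (\<integral>\<^sup>+y. ennreal (norm (F (a, y))) \<partial>N))"
    using A(1) by (simp add: N.nn_integral_fst[symmetric] uniform_count_measure_def
        nn_integral_point_measure_finite)
  also have "\<dots> < \<infinity>"
    using F A(1) by (auto simp: integrable_iff_bounded less_top[symmetric] ennreal_mult_eq_top_iff)
  finally show int: "integrable (uniform_count_measure A \<Otimes>\<^sub>M N) F"
    by (simp add: integrable_iff_bounded)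
  show "(\<integral>z. F z \<partial>(uniform_count_measure A \<Otimes>\<^sub>M N)) = (\<Sum>a\<in>A. \<integral>y. F (a, y) \<partial>N) / card A"
    using integral_fst'[OF int] integral_uniform_count_measure[OF A(1)] by simp
qed

lemma integral_PiM_component:
  fixes g :: "'a \<Rightarrow> real"
  assumes M: "\<And>i. i \<in> I \<Longrightarrow> prob_space (M i)" and "i \<in> I" and g: "integrable (M i) g"
  shows "integrable (Pi\<^sub>M I M) (\<lambda>x. g (x i))"
    and "(\<integral>x. g (x i) \<partial>Pi\<^sub>M I M) = (\<integral>t. g t \<partial>M i)"
proof -
  have [measurable]: "(\<lambda>x. x i) \<in> Pi\<^sub>M I M \<rightarrow>\<^sub>M M i" "g \<in> borel_measurable (M i)"
    using \<open>i \<in> I\<close> g by auto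
  have distr: "distr (Pi\<^sub>M I M) (M i) (\<lambda>x. x i) = M i"
    by (rule distr_PiM_component[OF M \<open>i \<in> I\<close>])
  show "integrable (Pi\<^sub>M I M) (\<lambda>x. g (x i))"
    using g integrable_distr_eq[of "\<lambda>x. x i" "Pi\<^sub>M I M" "M i" g] unfolding distr by simp
  show "(\<integral>x. g (x i) \<partial>Pi\<^sub>M I M) = (\<integral>t. g t \<partial>M i)"
    using integral_distr[of "\<lambda>x. x i" "Pi\<^sub>M I M" "M i" g] unfolding distr by simp
qed

lemma integral_PiM_two_components:
  fixes g h :: "'a \<Rightarrow> real"
  assumes "finite I" and M: "\<And>i. prob_space (M i)" and "i \<in> I" "j \<in> I" "i \<noteq> j"
    and g: "integrable (M i) g" and h: "integrable (M j) h"
  shows "integrable (Pi\<^sub>M I M) (\<lambda>x. g (x i) * h (x j))"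
    and "(\<integral>x. g (x i) * h (x j) \<partial>Pi\<^sub>M I M) = (\<integral>t. g t \<partial>M i) * (\<integral>t. h t \<partial>M j)"
proof -
  interpret product_sigma_finite M
    using M by (auto simp: product_sigma_finite_def intro: prob_space_imp_sigma_finite)
  define f where "f l = (if l = i then g else if l = j then h else (\<lambda>_. 1))" for l
  have f: "integrable (M l) (f l)" for l
    using g h prob_space.finite_measure[OF M] by (auto simp: f_def intro: finite_measure.integrable_const)
  have prod_f: "(\<Prod>l\<in>I. F l) = F i * F j" if "\<And>l. l \<notin> {i, j} \<Longrightarrow> F l = 1" for F :: "_ \<Rightarrow> real"
    using \<open>finite I\<close> \<open>i \<in> I\<close> \<open>j \<in> I\<close> \<open>i \<noteq> j\<close> that
    by (simp add: prod.remove[of I i] prod.remove[of "I - {i}" j] prod.neutral)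
  have "(\<Prod>l\<in>I. f l (x l)) = g (x i) * h (x j)" for x
    using \<open>i \<noteq> j\<close> by (subst prod_f) (auto simp: f_def)
  moreover have "(\<Prod>l\<in>I. \<integral>t. f l t \<partial>M l) = (\<integral>t. g t \<partial>M i) * (\<integral>t. h t \<partial>M j)"
    using \<open>i \<noteq> j\<close> by (subst prod_f) (auto simp: f_def prob_space.prob_space[OF M])
  ultimately show "integrable (Pi\<^sub>M I M) (\<lambda>x. g (x i) * h (x j))"
    and "(\<integral>x. g (x i) * h (x j) \<partial>Pi\<^sub>M I M) = (\<integral>t. g t \<partial>M i) * (\<integral>t. h t \<partial>M j)"
    using product_integrable_prod[OF \<open>finite I\<close> f] product_integral_prod[OF \<open>finite I\<close> f] by simp_all
qed

lemma sum_offdiagonal: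
  fixes F :: "nat \<times> nat \<Rightarrow> real"
  shows "(\<Sum>z\<in>{(i, j). i < q \<and> j < q \<and> i \<noteq> j}. F z) = (\<Sum>i<q. \<Sum>j<q. F (i, j)) - (\<Sum>i<q. F (i, i))"
proof -
  have "{..<q} \<times> {..<q} = {(i, j). i < q \<and> j < q \<and> i \<noteq> j} \<union> (\<lambda>i. (i, i)) ` {..<q}"
    by auto
  then have "(\<Sum>z\<in>{..<q} \<times> {..<q}. F z)
      = (\<Sum>z\<in>{(i, j). i < q \<and> j < q \<and> i \<noteq> j} \<union> (\<lambda>i. (i, i)) ` {..<q}. F z)"
    by simp
  also have "\<dots> = (\<Sum>z\<in>{(i, j). i < q \<and> j < q \<and> i \<noteq> j}. F z) + (\<Sum>z\<in>(\<lambda>i. (i, i)) ` {..<q}. F z)"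
    by (rule sum.union_disjoint) (auto intro: finite_subset[of _ "{..<q} \<times> {..<q}"])
  finally show ?thesis
    by (simp add: sum.cartesian_product sum.reindex inj_on_def)
qed

text \<open>\<open>M True\<close> and \<open>M False\<close> are the class-conditional distributions of the labels \<open>1\<close> and \<open>0\<close>;
  a bag consists of \<open>k\<close> independent points from \<open>M True\<close> followed by \<open>q - k\<close> from \<open>M False\<close>.\<close>

locale opposite_mean_classes =
  fixes M :: "bool \<Rightarrow> (real^'d::finite) measure" and S :: "real^'d^'d" and m :: "real^'d"
    and q k :: nat
  assumes prob_M: "prob_space (M y)"
    and integrable_second_moment: "integrable (M y) (\<lambda>x. (v \<bullet> x) * (w \<bullet> x))"
    and second_moment: "(\<integral>x. (v \<bullet> x) * (w \<bullet> x) \<partial>M y) = v \<bullet> (S *v w)"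
    and integrable_mean: "integrable (M y) (\<lambda>x. v \<bullet> x)"
    and mean: "(\<integral>x. v \<bullet> x \<partial>M y) = (if y then 1 else -1) * (v \<bullet> m)"
    and k_le_q: "k \<le> q"
begin

definition bag :: "(nat \<Rightarrow> real^'d) measure" where
  "bag = Pi\<^sub>M {..<q} (\<lambda>l. M (l < k))"

definition class_sign :: "nat \<Rightarrow> real" where
  "class_sign l = (if l < k then 1 else -1)"

lemma bag_measure_eq:
  assumes "M True = uniform_measure D {x. f x = 1}" and "M False = uniform_measure D {x. f x = 0}"
  shows "bag_measure D f q k = bag"
  unfolding bag_measure_def bag_def using assms by (metis (full_types))

lemma sum_class_sign: "(\<Sum>l<q. class_sign l) = 2 * real k - real q"
proof -
  have "(\<Sum>l<q. class_sign l) = (\<Sum>l<k. class_sign l) + (\<Sum>l\<in>{k..<q}. class_sign l)"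
    using sum.atLeastLessThan_concat[of 0 k q class_sign] k_le_q by (simp add: atLeast0LessThan)
  also have "\<dots> = (\<Sum>l<k. 1) + (\<Sum>l\<in>{k..<q}. - 1)"
    by (intro arg_cong2[where f = "(+)"] sum.cong) (auto simp: class_sign_def)
  finally show ?thesis
    using k_le_q by simp
qed

lemma class_moments:
  shows "integrable (M y) (\<lambda>x. x $ a)" and "(\<integral>x. x $ a \<partial>M y) = (if y then 1 else -1) * m $ a"
    and "integrable (M y) (\<lambda>x. x $ a * x $ c)" and "(\<integral>x. x $ a * x $ c \<partial>M y) = S $ a $ c"
  using integrable_mean[where y = y and v = "axis a 1"] mean[where y = y and v = "axis a 1"]
    integrable_second_moment[where y = y and v = "axis a 1" and w = "axis c 1"]
    second_moment[where y = y and v = "axis a 1" and w = "axis c 1"]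
  by (simp_all add: inner_axis' matrix_vector_mult_basis column_def)

lemma prob_bag: "prob_space bag"
  unfolding bag_def by (intro prob_space_PiM prob_M)

lemma class_centered_moment:
  "(\<integral>x. (x $ a - \<alpha>) * (x $ c - \<beta>) \<partial>M y)
     = S $ a $ c - (if y then 1 else -1) * (\<alpha> * m $ c + \<beta> * m $ a) + \<alpha> * \<beta>"
  "integrable (M y) (\<lambda>x. (x $ a - \<alpha>) * (x $ c - \<beta>))"
proof -
  interpret prob_space "M y"
    by (rule prob_M)
  have "(\<lambda>x. (x $ a - \<alpha>) * (x $ c - \<beta>)) = (\<lambda>x. x $ a * x $ c - \<alpha> * x $ c - \<beta> * x $ a + \<alpha> * \<beta>)"
    by (auto simp: algebra_simps)
  then show "(\<integral>x. (x $ a - \<alpha>) * (x $ c - \<beta>) \<partial>M y)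
     = S $ a $ c - (if y then 1 else -1) * (\<alpha> * m $ c + \<beta> * m $ a) + \<alpha> * \<beta>"
    and "integrable (M y) (\<lambda>x. (x $ a - \<alpha>) * (x $ c - \<beta>))"
    using class_moments[of y] by (simp_all add: prob_space algebra_simps)
qed

lemma bag_class_moments:
  "(\<integral>x. x $ a \<partial>M (l < k)) = class_sign l * m $ a"
  "(\<integral>x. (x $ a - \<alpha>) * (x $ c - \<beta>) \<partial>M (l < k))
     = S $ a $ c - class_sign l * (\<alpha> * m $ c + \<beta> * m $ a) + \<alpha> * \<beta>"
  by (simp_all add: class_sign_def class_moments class_centered_moment)

lemma integral_bag_point:
  assumes "0 < q" and g: "\<And>y. integrable (M y) g"
  shows "integrable (uniform_count_measure {..<q} \<Otimes>\<^sub>M bag) (\<lambda>z. g (snd z (fst z)))"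
    and "(\<integral>z. g (snd z (fst z)) \<partial>(uniform_count_measure {..<q} \<Otimes>\<^sub>M bag))
           = (\<Sum>l<q. \<integral>x. g x \<partial>M (l < k)) / q"
proof -
  have sf: "sigma_finite_measure bag"
    by (rule prob_space_imp_sigma_finite[OF prob_bag])
  note component = integral_PiM_component[of "{..<q}" "\<lambda>l. M (l < k)", OF prob_M _ g, folded bag_def]
  note pair = integral_uniform_count_measure_pair[OF _ _ sf, where A = "{..<q}" and F = "\<lambda>z. g (snd z (fst z))"]
  show "integrable (uniform_count_measure {..<q} \<Otimes>\<^sub>M bag) (\<lambda>z. g (snd z (fst z)))"
    using pair(1) \<open>0 < q\<close> component by auto
  show "(\<integral>z. g (snd z (fst z)) \<partial>(uniform_count_measure {..<q} \<Otimes>\<^sub>M bag))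
           = (\<Sum>l<q. \<integral>x. g x \<partial>M (l < k)) / q"
    using pair(2) \<open>0 < q\<close> component by auto
qed

lemma Sigma_B_eq:
  assumes "M True = uniform_measure D {x. f x = 1}" and "M False = uniform_measure D {x. f x = 0}"
    and "0 < q"
  shows "Sigma_B D f q k = (\<chi> a c. S $ a $ c - ((2 * real k - real q) / real q)\<^sup>2 * m $ a * m $ c)"
proof -
  define \<mu> where "\<mu> = (2 * real k - real q) / real q"
  note point = integral_bag_point[OF \<open>0 < q\<close>]
  have average: "(\<Sum>l<q. X + class_sign l * Y) / q = X + \<mu> * Y" for X Y
  proof -
    have "(\<Sum>l<q. X + class_sign l * Y) = real q * X + (2 * real k - real q) * Y"
      by (simp add: sum.distrib sum_distrib_right[symmetric] sum_class_sign)
    then show ?thesis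
      using \<open>0 < q\<close> by (simp add: \<mu>_def field_simps)
  qed
  have mean: "(\<integral>z. snd z (fst z) $ a \<partial>(uniform_count_measure {..<q} \<Otimes>\<^sub>M bag)) = \<mu> * m $ a" for a
    using point[of "\<lambda>x. x $ a"] average[of 0 "m $ a"] by (simp add: class_moments(1) bag_class_moments)
  have entry: "(\<integral>z. (snd z (fst z) $ a - \<mu> * m $ a) * (snd z (fst z) $ c - \<mu> * m $ c)
        \<partial>(uniform_count_measure {..<q} \<Otimes>\<^sub>M bag)) = S $ a $ c - \<mu>\<^sup>2 * m $ a * m $ c" for a c
  proof -
    have per_class: "(\<integral>x. (x $ a - \<mu> * m $ a) * (x $ c - \<mu> * m $ c) \<partial>M (l < k))
        = (S $ a $ c + \<mu>\<^sup>2 * m $ a * m $ c) + class_sign l * (- 2 * \<mu> * m $ a * m $ c)" for l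
      unfolding bag_class_moments by (simp add: power2_eq_square algebra_simps)
    have "(\<integral>z. (snd z (fst z) $ a - \<mu> * m $ a) * (snd z (fst z) $ c - \<mu> * m $ c)
        \<partial>(uniform_count_measure {..<q} \<Otimes>\<^sub>M bag))
        = (\<Sum>l<q. \<integral>x. (x $ a - \<mu> * m $ a) * (x $ c - \<mu> * m $ c) \<partial>M (l < k)) / q"
      by (rule point(2)) (rule class_centered_moment(2))
    also have "\<dots> = (S $ a $ c + \<mu>\<^sup>2 * m $ a * m $ c) + \<mu> * (- 2 * \<mu> * m $ a * m $ c)"
      unfolding per_class by (rule average)
    finally show ?thesis
      by (simp add: power2_eq_square)
  qed
  show ?thesis
    unfolding Sigma_B_def point_measure'_def bag_measure_eq[OF assms(1,2)] Let_def
    by (simp add: case_prod_beta mean entry vec_eq_iff flip: \<mu>_def)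
qed

lemma integral_bag_pair_difference:
  assumes "i < q" "j < q" "i \<noteq> j"
  shows "integrable bag (\<lambda>b. (b i $ a - b j $ a) * (b i $ c - b j $ c))"
    and "(\<integral>b. (b i $ a - b j $ a) * (b i $ c - b j $ c) \<partial>bag)
           = 2 * S $ a $ c - 2 * class_sign i * class_sign j * m $ a * m $ c"
proof -
  have expand: "(\<lambda>b :: nat \<Rightarrow> real^'d. (b i $ a - b j $ a) * (b i $ c - b j $ c))
      = (\<lambda>b. b i $ a * b i $ c + b j $ a * b j $ c - b i $ a * b j $ c - b j $ a * b i $ c)"
    by (rule ext) (simp add: algebra_simps)
  note one = integral_PiM_component[of "{..<q}" "\<lambda>l. M (l < k)", OF prob_M _ class_moments(3), folded bag_def]
  note two = integral_PiM_two_components[of "{..<q}" "\<lambda>l. M (l < k)", OF _ prob_M _ _ _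
      class_moments(1) class_moments(1), folded bag_def]
  show "integrable bag (\<lambda>b. (b i $ a - b j $ a) * (b i $ c - b j $ c))"
    unfolding expand using assms by (intro Bochner_Integration.integrable_add
        Bochner_Integration.integrable_diff one two) auto
  show "(\<integral>b. (b i $ a - b j $ a) * (b i $ c - b j $ c) \<partial>bag)
           = 2 * S $ a $ c - 2 * class_sign i * class_sign j * m $ a * m $ c"
    unfolding expand using assms
    by (simp add: one two class_moments bag_class_moments class_sign_def algebra_simps)
qed

lemma Sigma_D_eq:
  assumes "M True = uniform_measure D {x. f x = 1}" and "M False = uniform_measure D {x. f x = 0}"
    and "2 \<le> q"
  shows "Sigma_D D f q k = (\<chi> a c. 2 * S $ a $ c
           - 2 * ((2 * real k - real q)\<^sup>2 - real q) / (real q * (real q - 1)) * m $ a * m $ c)"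
proof -
  define P where "P = {(i, j). i < q \<and> j < q \<and> i \<noteq> j}"
  have "finite P"
    unfolding P_def by (rule finite_subset[of _ "{..<q} \<times> {..<q}"]) auto
  have "(0, 1) \<in> P"
    using \<open>2 \<le> q\<close> by (simp add: P_def)
  then have "P \<noteq> {}"
    by blast
  have card_P: "real (card P) = real q * (real q - 1)"
    using sum_offdiagonal[where q = q and F = "\<lambda>_. 1"] by (simp add: P_def algebra_simps)
  have "class_sign i * class_sign i = 1" for i
    by (simp add: class_sign_def)
  then have sum_P_signs: "(\<Sum>z\<in>P. class_sign (fst z) * class_sign (snd z)) = (2 * real k - real q)\<^sup>2 - real q"
    using sum_offdiagonal[where q = q and F = "\<lambda>z. class_sign (fst z) * class_sign (snd z)"]
    by (simp add: P_def sum_product[symmetric] sum_class_sign power2_eq_square)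
  have entry: "(\<integral>z. (snd z (fst (fst z)) $ a - snd z (snd (fst z)) $ a)
        * (snd z (fst (fst z)) $ c - snd z (snd (fst z)) $ c) \<partial>(uniform_count_measure P \<Otimes>\<^sub>M bag))
      = 2 * S $ a $ c - 2 * ((2 * real k - real q)\<^sup>2 - real q) / (real q * (real q - 1)) * m $ a * m $ c"
    for a c
  proof -
    note pair = integral_uniform_count_measure_pair[OF \<open>finite P\<close> \<open>P \<noteq> {}\<close>
        prob_space_imp_sigma_finite[OF prob_bag]]
    have "(\<integral>z. (snd z (fst (fst z)) $ a - snd z (snd (fst z)) $ a)
        * (snd z (fst (fst z)) $ c - snd z (snd (fst z)) $ c) \<partial>(uniform_count_measure P \<Otimes>\<^sub>M bag))
        = (\<Sum>z\<in>P. \<integral>b. (b (fst z) $ a - b (snd z) $ a) * (b (fst z) $ c - b (snd z) $ c) \<partial>bag) / card P"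
      by (rule pair(2)[where F = "\<lambda>z. (snd z (fst (fst z)) $ a - snd z (snd (fst z)) $ a)
          * (snd z (fst (fst z)) $ c - snd z (snd (fst z)) $ c)", simplified])
        (auto simp: P_def intro!: integral_bag_pair_difference(1))
    also have "\<dots> = (\<Sum>z\<in>P. 2 * S $ a $ c - 2 * m $ a * m $ c * (class_sign (fst z) * class_sign (snd z)))
        / card P"
      by (intro arg_cong2[where f = "(/)"] sum.cong refl)
        (auto simp: P_def integral_bag_pair_difference(2) mult_ac)
    also have "\<dots> = (real (card P) * (2 * S $ a $ c) - 2 * m $ a * m $ c * ((2 * real k - real q)\<^sup>2 - real q))
        / card P"
      by (simp add: sum_subtractf sum_distrib_left[symmetric] sum_P_signs)
    also have "\<dots> = 2 * S $ a $ c - 2 * ((2 * real k - real q)\<^sup>2 - real q) / (real q * (real q - 1)) * m $ a * m $ c"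
      using \<open>2 \<le> q\<close> by (simp add: card_P field_simps)
    finally show ?thesis .
  qed
  show ?thesis
    unfolding Sigma_D_def pair_point_measure_def bag_measure_eq[OF assms(1,2)] Let_def P_def[symmetric]
    by (simp add: case_prod_beta entry vec_eq_iff)
qed

end

section \<open>The covariance forms of the oracle\<close>

lemma quad_rank_one_update:
  fixes S :: "real^'n::finite^'n" and m r :: "real^'n"
  shows "quad (\<chi> a c. \<alpha> * S $ a $ c - \<beta> * m $ a * m $ c) r = \<alpha> * quad S r - \<beta> * (r \<bullet> m)\<^sup>2"
proof -
  have eq: "(\<chi> a c. \<alpha> * S $ a $ c - \<beta> * m $ a * m $ c) *v r = \<alpha> *\<^sub>R (S *v r) - (\<beta> * (m \<bullet> r)) *\<^sub>R m"
    by (simp add: vec_eq_iff matrix_vector_mult_def inner_vec_def sum_subtractf sum_distrib_left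
        algebra_simps)
  show ?thesis
    unfolding quad_def eq by (simp add: inner_diff_right power2_eq_square inner_commute algebra_simps)
qed

lemma pos_label_classes:
  "{x. pos (r \<bullet> x) = 1} = {x. r \<bullet> x \<in> halfline True}"
  "{x. pos (r \<bullet> x) = 0} = {x. r \<bullet> x \<in> halfline False}"
  by (auto simp: pos_def halfline_def)

lemma opposite_mean_classes_gauss:
  fixes S :: "real^'n::finite^'n" and r :: "real^'n"
  assumes "sym_posdef S" and "r \<noteq> 0" and "k \<le> q"
  shows "opposite_mean_classes (\<lambda>b. uniform_measure (gauss S) {x. r \<bullet> x \<in> halfline b}) S
           ((sqrt (2 / pi) / sqrt (quad S r)) *\<^sub>R (S *v r)) q k"
  using gauss_halfspace_moments[OF assms(1,2)] assms(3)
  by (intro opposite_mean_classes.intro) simp_all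

lemma
  fixes S :: "real^'n::finite^'n" and rstar r :: "real^'n"
  assumes S: "sym_posdef S" and "rstar \<noteq> 0" and "k \<le> q"
  shows quad_Sigma_B_gauss: "0 < q \<Longrightarrow> quad (Sigma_B (gauss S) (\<lambda>x. pos (rstar \<bullet> x)) q k) r
           = quad S r - ((2 * real k - real q) / real q)\<^sup>2 * ((2 / pi) * ((r \<bullet> (S *v rstar))\<^sup>2 / quad S rstar))"
      (is "_ \<Longrightarrow> ?B")
    and quad_Sigma_D_gauss: "2 \<le> q \<Longrightarrow> quad (Sigma_D (gauss S) (\<lambda>x. pos (rstar \<bullet> x)) q k) r
           = 2 * quad S r - 2 * ((2 * real k - real q)\<^sup>2 - real q) / (real q * (real q - 1))
               * ((2 / pi) * ((r \<bullet> (S *v rstar))\<^sup>2 / quad S rstar))"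
      (is "_ \<Longrightarrow> ?D")
proof -
  define m where "m = (sqrt (2 / pi) / sqrt (quad S rstar)) *\<^sub>R (S *v rstar)"
  interpret opposite_mean_classes "\<lambda>b. uniform_measure (gauss S) {x. rstar \<bullet> x \<in> halfline b}" S m q k
    unfolding m_def by (rule opposite_mean_classes_gauss[OF assms])
  have "quad S rstar > 0"
    using S \<open>rstar \<noteq> 0\<close> by (simp add: quad_def sym_posdef_def)
  then have rm: "(r \<bullet> m)\<^sup>2 = (2 / pi) * ((r \<bullet> (S *v rstar))\<^sup>2 / quad S rstar)"
    by (simp add: m_def power_mult_distrib power_divide)
  show ?B if "0 < q"
    using quad_rank_one_update[of 1 S _ m r]
    by (subst Sigma_B_eq) (simp_all add: pos_label_classes that rm)
  show ?D if "2 \<le> q"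
  proof -
    have "Sigma_D (gauss S) (\<lambda>x. pos (rstar \<bullet> x)) q k = (\<chi> a c. 2 * S $ a $ c
        - 2 * ((2 * real k - real q)\<^sup>2 - real q) / (real q * (real q - 1)) * m $ a * m $ c)"
      by (rule Sigma_D_eq) (simp_all add: pos_label_classes that)
    then show ?thesis
      by (simp only: quad_rank_one_update rm)
  qed
qed

definition cos_wrt :: "real^'n^'n \<Rightarrow> real^'n \<Rightarrow> real^'n \<Rightarrow> real" where
  "cos_wrt S r s = (r \<bullet> (S *v s)) / (sqrt (quad S r) * sqrt (quad S s))"

lemma
  fixes S :: "real^'n::finite^'n"
  assumes "sym_posdef S" and "r \<noteq> 0" and "s \<noteq> 0"
  shows quad_mult_cos_wrt_sq: "quad S r * (cos_wrt S r s)\<^sup>2 = (r \<bullet> (S *v s))\<^sup>2 / quad S s"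
    and cos_wrt_sq_le_one: "(cos_wrt S r s)\<^sup>2 \<le> 1"
proof -
  have "0 < quad S r" and "0 < quad S s"
    using assms by (simp_all add: sym_posdef_def quad_def)
  then have cos_sq: "(cos_wrt S r s)\<^sup>2 = (r \<bullet> (S *v s))\<^sup>2 / (quad S r * quad S s)"
    by (simp add: cos_wrt_def power_divide power_mult_distrib)
  show "quad S r * (cos_wrt S r s)\<^sup>2 = (r \<bullet> (S *v s))\<^sup>2 / quad S s"
    using \<open>0 < quad S r\<close> by (simp add: cos_sq)
  show "(cos_wrt S r s)\<^sup>2 \<le> 1"
    using sym_posdef_cauchy_schwarz[OF assms(1), of r s] \<open>0 < quad S r\<close> \<open>0 < quad S s\<close>
    by (simp add: cos_sq)
qed

lemma cos_wrt_sq_self: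
  fixes S :: "real^'n::finite^'n"
  assumes "sym_posdef S" and "s \<noteq> 0"
  shows "(cos_wrt S s s)\<^sup>2 = 1" and "(cos_wrt S (- s) s)\<^sup>2 = 1"
proof -
  have "quad S s > 0" and "quad S (- s) = quad S s" and "(- s) \<bullet> (S *v s) = - quad S s"
    using assms by (simp_all add: sym_posdef_def quad_def linear_neg[OF matrix_vector_mul_linear])
  then show "(cos_wrt S s s)\<^sup>2 = 1" and "(cos_wrt S (- s) s)\<^sup>2 = 1"
    by (simp_all add: cos_wrt_def quad_def power_divide power_mult_distrib power2_eq_square)
qed

lemma kappa_bounds:
  assumes "2 \<le> q" and "k \<le> q"
  shows "0 \<le> (2 * real k / real q - 1)\<^sup>2 * (2 / pi)"
    and "(2 * real k / real q - 1)\<^sup>2 * (2 / pi) < 1"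
    and "0 \<le> (1 / (real q - 1)) * (real k / real q) * (1 - real k / real q) * (16 / pi)"
proof -
  have "\<bar>2 * real k / real q - 1\<bar> \<le> 1"
    using assms by (simp add: abs_le_iff field_simps)
  then have "(2 * real k / real q - 1)\<^sup>2 \<le> 1"
    using abs_le_square_iff[of "2 * real k / real q - 1" 1] by simp
  then have "(2 * real k / real q - 1)\<^sup>2 * (2 / pi) \<le> 2 / pi"
    using mult_right_mono[of _ 1 "2 / pi"] by simp
  also have "2 / pi < 1"
    using pi_gt3 by simp
  finally show "(2 * real k / real q - 1)\<^sup>2 * (2 / pi) < 1" .
  show "0 \<le> (2 * real k / real q - 1)\<^sup>2 * (2 / pi)"
    and "0 \<le> (1 / (real q - 1)) * (real k / real q) * (1 - real k / real q) * (16 / pi)"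
    using assms by simp_all
qed

lemma pos_label_covariance_forms:
  fixes S :: "real^'n::finite^'n" and rstar r :: "real^'n"
  assumes S: "sym_posdef S" and "rstar \<noteq> 0" and "r \<noteq> 0" and "2 \<le> q" and "k \<le> q"
  shows "quad (Sigma_B (gauss S) (\<lambda>x. pos (rstar \<bullet> x)) q k) r
           = quad S r * (1 - (cos_wrt S r rstar)\<^sup>2 * ((2 * real k / real q - 1)\<^sup>2 * (2 / pi)))"
      (is ?B)
    and "quad (Sigma_D (gauss S) (\<lambda>x. pos (rstar \<bullet> x)) q k) r
           = quad S r * (2 - (cos_wrt S r rstar)\<^sup>2 * (2 * ((2 * real k / real q - 1)\<^sup>2 * (2 / pi))
               - (1 / (real q - 1)) * (real k / real q) * (1 - real k / real q) * (16 / pi)))"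
      (is ?D)
proof -
  have "0 < q"
    using \<open>2 \<le> q\<close> by simp
  have coeff_B: "((2 * real k - real q) / real q)\<^sup>2 * ((2 / pi) * Y) = (2 * real k / real q - 1)\<^sup>2 * (2 / pi) * Y"
    and coeff_D: "2 * ((2 * real k - real q)\<^sup>2 - real q) / (real q * (real q - 1)) * ((2 / pi) * Y)
      = (2 * ((2 * real k / real q - 1)\<^sup>2 * (2 / pi))
        - (1 / (real q - 1)) * (real k / real q) * (1 - real k / real q) * (16 / pi)) * Y" for Y
    using \<open>2 \<le> q\<close> by (simp_all add: field_simps power2_eq_square)
  show ?B and ?D
    unfolding quad_Sigma_B_gauss[OF assms(1,2,5) \<open>0 < q\<close>] quad_Sigma_D_gauss[OF assms(1,2,5,4)]
      quad_mult_cos_wrt_sq[OF assms(1,3,2), symmetric] coeff_B coeff_D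
    by (simp_all add: algebra_simps)
qed

lemma covariance_ratio_eq:
  fixes \<sigma> g \<kappa>1 \<kappa>2 :: real
  assumes "0 < \<sigma>" and "g \<le> 1" and "0 \<le> \<kappa>1" and "\<kappa>1 < 1"
  shows "\<sigma> * (2 - g * (2 * \<kappa>1 - \<kappa>2)) / (\<sigma> * (1 - g * \<kappa>1)) = 2 + g * \<kappa>2 / (1 - g * \<kappa>1)"
proof -
  have "g * \<kappa>1 < 1"
    using mult_right_mono[OF \<open>g \<le> 1\<close> \<open>0 \<le> \<kappa>1\<close>] \<open>\<kappa>1 < 1\<close> by simp
  then show ?thesis
    using \<open>0 < \<sigma>\<close> by (simp add: field_simps)
qed

lemma covariance_ratio_mono:
  fixes g \<kappa>1 \<kappa>2 :: real
  assumes "0 \<le> g" "g \<le> 1" "0 \<le> \<kappa>1" "\<kappa>1 < 1" "0 \<le> \<kappa>2"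
  shows "g * \<kappa>2 / (1 - g * \<kappa>1) \<le> \<kappa>2 / (1 - \<kappa>1)"
proof (rule frac_le)
  show "g * \<kappa>2 \<le> \<kappa>2" and "1 - \<kappa>1 \<le> 1 - g * \<kappa>1"
    using mult_right_mono[OF \<open>g \<le> 1\<close>, of \<kappa>2] mult_right_mono[OF \<open>g \<le> 1\<close>, of \<kappa>1] assms by simp_all
qed (use assms in auto)

theorem lemma6:
  fixes S :: "real^'d^'d" and rstar :: "real^'d" and q k :: nat
  assumes symm: "transpose S = S"
    and posdef: "\<forall>x. x \<noteq> 0 \<longrightarrow> x \<bullet> (S *v x) > 0"
    and rstar_nz: "rstar \<noteq> 0"
    and q: "q \<ge> 2" and k1: "1 \<le> k" and k2: "k \<le> q - 1"
  defines "SB \<equiv> Sigma_B (gauss S) (\<lambda>x. pos (rstar \<bullet> x)) q k"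
    and "SD \<equiv> Sigma_D (gauss S) (\<lambda>x. pos (rstar \<bullet> x)) q k"
    and "\<kappa>1 \<equiv> (2 * real k / real q - 1)^2 * (2 / pi)"
    and "\<kappa>2 \<equiv> (1 / (real q - 1)) * (real k / real q) * (1 - real k / real q) * (16 / pi)"
    and "\<rho> \<equiv> (\<lambda>r. quad (Sigma_D (gauss S) (\<lambda>x. pos (rstar \<bullet> x)) q k) r / quad (Sigma_B (gauss S) (\<lambda>x. pos (rstar \<bullet> x)) q k) r)"
    and "\<gamma> \<equiv> (\<lambda>r. (r \<bullet> (S *v rstar)) / (sqrt (quad S r) * sqrt (quad S rstar)))"
  shows "\<forall>r. r \<noteq> 0 \<longrightarrow>
           quad SB r = quad S r * (1 - (\<gamma> r)^2 * \<kappa>1)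
         \<and> quad SD r = quad S r * (2 - (\<gamma> r)^2 * (2 * \<kappa>1 - \<kappa>2))
         \<and> \<rho> r = 2 + (\<gamma> r)^2 * \<kappa>2 / (1 - (\<gamma> r)^2 * \<kappa>1)
         \<and> \<rho> r \<le> \<rho> rstar \<and> \<rho> r \<le> \<rho> (- rstar)"
proof -
  have S: "sym_posdef S"
    using symm posdef by (simp add: sym_posdef_def)
  have "k \<le> q"
    using k2 by simp
  have \<gamma>: "\<gamma> r = cos_wrt S r rstar" for r
    by (simp add: \<gamma>_def cos_wrt_def)
  have \<kappa>: "0 \<le> \<kappa>1" "\<kappa>1 < 1" "0 \<le> \<kappa>2"
    using kappa_bounds[OF q \<open>k \<le> q\<close>] by (simp_all add: \<kappa>1_def \<kappa>2_def)
  have forms: "quad SB r = quad S r * (1 - (\<gamma> r)^2 * \<kappa>1)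
         \<and> quad SD r = quad S r * (2 - (\<gamma> r)^2 * (2 * \<kappa>1 - \<kappa>2))
         \<and> \<rho> r = 2 + (\<gamma> r)^2 * \<kappa>2 / (1 - (\<gamma> r)^2 * \<kappa>1)" if "r \<noteq> 0" for r
  proof -
    have "0 < quad S r"
      using posdef that by (simp add: quad_def)
    then show ?thesis
      using pos_label_covariance_forms[OF S rstar_nz that q \<open>k \<le> q\<close>, folded \<kappa>1_def \<kappa>2_def]
        covariance_ratio_eq[OF _ cos_wrt_sq_le_one[OF S that rstar_nz] \<kappa>(1,2)]
      by (simp add: SB_def SD_def \<rho>_def \<gamma>)
  qed
  then have \<rho>_rstar: "\<rho> rstar = 2 + \<kappa>2 / (1 - \<kappa>1)" "\<rho> (- rstar) = 2 + \<kappa>2 / (1 - \<kappa>1)"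
    using cos_wrt_sq_self[OF S rstar_nz] rstar_nz by (simp_all add: \<gamma>)
  have "\<rho> r \<le> 2 + \<kappa>2 / (1 - \<kappa>1)" if "r \<noteq> 0" for r
    using forms[OF that] covariance_ratio_mono[OF zero_le_power2 cos_wrt_sq_le_one[OF S that rstar_nz] \<kappa>]
    by (simp add: \<gamma>)
  then show ?thesis
    using forms \<rho>_rstar by simp
qed

end
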